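(* Let $\Phi,\Psi$ be invertible $N_x\times N_x$ matrices with $\|\Phi^q\|<1$, $\|\Psi^q\|<1$ for some $q\ge 1$ (fine- and coarse-grid time-stepping operators), with coarsening factor $k$ and $N_c$ coarse-grid time points, and let $A_\Delta$, $B_\Delta$, $A_{cf}A_{ff}^{-1}A_{fc}$ be the associated $N_c\times N_c$ block matrices. Assume that $\Psi-\Phi^k$ is invertible. (a) If $\Phi$ satisfies an F-TAP$_1$ with respect to $\Psi$, with minimum constant $\varphi_{F,1}$, then $$\|I-A_\Delta B_\Delta^{-1}\|\ge\frac{\varphi_{F,1}}{1+O(1/\sqrt{N_c})}.$$ If, further, $\Phi\Psi=\Psi\Phi$ and $\Phi$ satisfies an F-TAP$_p$ with respect to $\Psi$ with minimum constant $\varphi_{F,p}$, then $$\|(I-A_\Delta B_\Delta^{-1})^p\|\ge\frac{\varphi_{F,p}}{1+O(1/\sqrt{N_c})}.$$ (b) If $\Phi$ satisfies an FCF-TAP$_1$ with respect to $\Psi$, with minimum constant $\varphi_{FCF,1}$, then $$\|(I-A_\Delta B_\Delta^{-1})A_{cf}A_{ff}^{-1}A_{fc}\|\ge\frac{\varphi_{FCF,1}}{1+O(1/\sqrt{N_c})}.$$ If, further, $\Phi\Psi=\Psi\Phi$ and $\Phi$ satisfies an FCF-TAP$_p$ with respect to $\Psi$ with minimum constant $\varphi_{FCF,p}$, then $$\left\|\left((I-A_\Delta B_\Delta^{-1})A_{cf}A_{ff}^{-1}A_{fc}\right)^p\right\|\ge\frac{\varphi_{FCF,p}}{1+O(1/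\sqrt{N_c})}.$$
   Context: $\|\cdot\|$ is the Euclidean ($\ell^2$) vector norm and induced matrix norm. $A_\Delta$ and $B_\Delta$ are the $N_c\times N_c$ block matrices (blocks of size $N_x\times N_x$) with identity blocks on the diagonal, zeros elsewhere except on the first block subdiagonal, where $A_\Delta$ has $-\Phi^k$ and $B_\Delta$ has $-\Psi$. $A_{cf}A_{ff}^{-1}A_{fc}$ is the $N_c\times N_c$ block matrix with $\Phi^k$ on the first block subdiagonal and zeros elsewhere. Temporal approximation property (TAP): $\Phi$ satisfies an F-TAP$_p$ with respect to $\Psi$ with constant $\varphi_{F,p}$ if for all vectors $\mathbf{v}$ $$\|(\Psi-\Phi^k)^p\mathbf{v}\|\le\varphi_{F,p}\min_{x\in[0,2\pi]}\|(I-e^{\mathrm{i}x}\Psi)^p\mathbf{v}\|,$$ and an FCF-TAP$_p$ with constant $\varphi_{FCF,p}$ if for all $\mathbf{v}$ $$\|(\Psi-\Phi^k)^p\mathbf{v}\|\le\varphi_{FCF,p}\min_{x\in[0,2\pi]}\|(\Phi^{-k}(I-e^{\mathrm{i}x}\Psi))^p\mathbf{v}\|.$$ The minimum constant is the smallest one for which the inequality holds for all $\mathbf{v}$. Convention: $O(1/\sqrt{N_c})$ denotes a nonnegative quantity bounded by $C/\sqrt{N_c}$ as $N_c\to\infty$ with $\Phi,\Psi,k,p$ fixed. *)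

theory Defs
  imports
    "HOL-Analysis.L2_Norm"
    "HOL-Library.Landau_Symbols"
    "Jordan_Normal_Form.Gauss_Jordan_Elimination"
begin

definition l2_norm_vec :: "complex vec \<Rightarrow> real" where
  "l2_norm_vec v = L2_set (\<lambda>i. cmod (v $ i)) {..<dim_vec v}"

definition l2_norm_mat :: "complex mat \<Rightarrow> real" where
  "l2_norm_mat A =
     (SUP v \<in> carrier_vec (dim_col A) - {0\<^sub>v (dim_col A)}. l2_norm_vec (A *\<^sub>v v) / l2_norm_vec v)"

text \<open>Only meaningful for invertible matrices; see the lemma below.\<close>

definition mat_inv :: "complex mat \<Rightarrow> complex mat" where
  "mat_inv A = the (mat_inverse A)"

lemma mat_inv:
  assumes A: "A \<in> carrier_mat n n" and inv: "invertible_mat A"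
  shows "mat_inv A \<in> carrier_mat n n" "A * mat_inv A = 1\<^sub>m n" "mat_inv A * A = 1\<^sub>m n"
proof -
  obtain B where AB: "A * B = 1\<^sub>m (dim_row A)" and BA: "B * A = 1\<^sub>m (dim_row B)"
    using inv unfolding invertible_mat_def inverts_mat_def by auto
  have dc: "dim_col B = n"
    using arg_cong[OF AB, of dim_col] A by simp
  have dr: "dim_row B = n"
    using arg_cong[OF BA, of dim_col] A by simp
  have B: "B \<in> carrier_mat n n" using dc dr by auto
  have "A \<in> Units (ring_mat TYPE(complex) n ())"
    using A B AB BA dr unfolding Units_def ring_mat_def by auto
  then obtain C where "mat_inverse A = Some C"
    using mat_inverse(1)[OF A, of "()"] by (cases "mat_inverse A") auto
  with mat_inverse(2)[OF A this]
  show "mat_inv A \<in> carrier_mat n n" "A * mat_inv A = 1\<^sub>m n" "mat_inv A * A = 1\<^sub>m n"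
    unfolding mat_inv_def by auto
qed

text \<open>The \<open>N \<times> N\<close> block matrix whose block in block row \<open>i\<close> and block column \<open>j\<close> is the
  \<open>n \<times> n\<close> matrix \<open>M i j\<close>.\<close>

definition block_matrix :: "nat \<Rightarrow> nat \<Rightarrow> (nat \<Rightarrow> nat \<Rightarrow> complex mat) \<Rightarrow> complex mat" where
  "block_matrix N n M =
     mat (N * n) (N * n) (\<lambda>(r, c). M (r div n) (c div n) $$ (r mod n, c mod n))"

definition subdiag_matrix :: "nat \<Rightarrow> complex mat \<Rightarrow> complex mat \<Rightarrow> complex mat" where
  "subdiag_matrix N D S = block_matrix N (dim_row D) (\<lambda>i j.
     if i = j then D else if i = Suc j then S else 0\<^sub>m (dim_row D) (dim_row D))"

definition A_Delta :: "complex mat \<Rightarrow> nat \<Rightarrow> nat \<Rightarrow> complex mat" where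
  "A_Delta \<Phi> k N = subdiag_matrix N (1\<^sub>m (dim_row \<Phi>)) (- (\<Phi> ^\<^sub>m k))"

definition B_Delta :: "complex mat \<Rightarrow> nat \<Rightarrow> complex mat" where
  "B_Delta \<Psi> N = subdiag_matrix N (1\<^sub>m (dim_row \<Psi>)) (- \<Psi>)"

text \<open>The product \<open>A_cf A_ff\<^sup>-\<^sup>1 A_fc\<close>.\<close>

definition A_cf_ff_fc :: "complex mat \<Rightarrow> nat \<Rightarrow> nat \<Rightarrow> complex mat" where
  "A_cf_ff_fc \<Phi> k N = subdiag_matrix N (0\<^sub>m (dim_row \<Phi>) (dim_row \<Phi>)) (\<Phi> ^\<^sub>m k)"

definition err_F :: "complex mat \<Rightarrow> complex mat \<Rightarrow> nat \<Rightarrow> nat \<Rightarrow> complex mat" where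
  "err_F \<Phi> \<Psi> k N = 1\<^sub>m (N * dim_row \<Phi>) - A_Delta \<Phi> k N * mat_inv (B_Delta \<Psi> N)"

definition err_FCF :: "complex mat \<Rightarrow> complex mat \<Rightarrow> nat \<Rightarrow> nat \<Rightarrow> complex mat" where
  "err_FCF \<Phi> \<Psi> k N = err_F \<Phi> \<Psi> k N * A_cf_ff_fc \<Phi> k N"

text \<open>The infima over \<open>x\<close> below are minima; see the lemmas \<open>F_TAP_min\<close> and \<open>FCF_TAP_min\<close>.\<close>

definition F_TAP :: "complex mat \<Rightarrow> complex mat \<Rightarrow> nat \<Rightarrow> nat \<Rightarrow> real \<Rightarrow> bool" where
  "F_TAP \<Phi> \<Psi> k p c \<longleftrightarrow> (\<forall>v \<in> carrier_vec (dim_row \<Phi>).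
     l2_norm_vec ((\<Psi> - \<Phi> ^\<^sub>m k) ^\<^sub>m p *\<^sub>v v) \<le>
       c * (INF x \<in> {0..2 * pi}. l2_norm_vec ((1\<^sub>m (dim_row \<Phi>) - cis x \<cdot>\<^sub>m \<Psi>) ^\<^sub>m p *\<^sub>v v)))"

definition FCF_TAP :: "complex mat \<Rightarrow> complex mat \<Rightarrow> nat \<Rightarrow> nat \<Rightarrow> real \<Rightarrow> bool" where
  "FCF_TAP \<Phi> \<Psi> k p c \<longleftrightarrow> (\<forall>v \<in> carrier_vec (dim_row \<Phi>).
     l2_norm_vec ((\<Psi> - \<Phi> ^\<^sub>m k) ^\<^sub>m p *\<^sub>v v) \<le>
       c * (INF x \<in> {0..2 * pi}.
         l2_norm_vec ((mat_inv (\<Phi> ^\<^sub>m k) * (1\<^sub>m (dim_row \<Phi>) - cis x \<cdot>\<^sub>m \<Psi>)) ^\<^sub>m p *\<^sub>v v)))"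

lemma norm_pow_attains_INF:
  fixes M :: "real \<Rightarrow> complex mat"
  assumes M: "\<And>x. M x \<in> carrier_mat n n"
    and cont: "\<And>i j. i < n \<Longrightarrow> j < n \<Longrightarrow> continuous_on {0..2 * pi} (\<lambda>x. M x $$ (i, j))"
    and v: "v \<in> carrier_vec n"
  shows "\<exists>y \<in> {0..2 * pi}. (INF x \<in> {0..2 * pi}. l2_norm_vec (M x ^\<^sub>m p *\<^sub>v v)) =
           l2_norm_vec (M y ^\<^sub>m p *\<^sub>v v)"
proof -
  let ?f = "\<lambda>x. l2_norm_vec (M x ^\<^sub>m p *\<^sub>v v)"
  have [simp]: "dim_row (M x) = n" "dim_col (M x) = n" for x
    using M[of x] by auto
  have P: "M x ^\<^sub>m q \<in> carrier_mat n n" for x q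
    using M[of x] by simp
  have pow: "continuous_on {0..2 * pi} (\<lambda>x. (M x ^\<^sub>m q) $$ (i, j))" if "i < n" "j < n" for q i j
    using that
  proof (induction q arbitrary: i j)
    case 0
    then show ?case by simp
  next
    case (Suc q)
    have "(M x ^\<^sub>m Suc q) $$ (i, j) = (\<Sum>l<n. (M x ^\<^sub>m q) $$ (i, l) * M x $$ (l, j))" for x
      using Suc.prems P[of x q] by (auto simp: scalar_prod_def lessThan_atLeast0 intro!: sum.cong)
    then show ?case
      using Suc cont by (auto intro!: continuous_intros)
  qed
  have "?f x = sqrt (\<Sum>i<n. (cmod (\<Sum>l<n. (M x ^\<^sub>m p) $$ (i, l) * v $ l))\<^sup>2)" for x
    using v P[of x p]
    by (auto simp: l2_norm_vec_def L2_set_def scalar_prod_def lessThan_atLeast0 intro!: sum.cong)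
  then have "continuous_on {0..2 * pi} ?f"
    using pow by (auto intro!: continuous_intros)
  then obtain y where y: "y \<in> {0..2 * pi}" "\<forall>x\<in>{0..2 * pi}. ?f y \<le> ?f x"
    using continuous_attains_inf[of "{0..2 * pi}" ?f] by auto
  then have "(INF x \<in> {0..2 * pi}. ?f x) = ?f y"
    by (intro cInf_eq_minimum) auto
  with y(1) show ?thesis by blast
qed

lemma F_TAP_min:
  assumes "\<Psi> \<in> carrier_mat n n" and "v \<in> carrier_vec n"
  shows "\<exists>y \<in> {0..2 * pi}.
    (INF x \<in> {0..2 * pi}. l2_norm_vec ((1\<^sub>m n - cis x \<cdot>\<^sub>m \<Psi>) ^\<^sub>m p *\<^sub>v v)) =
      l2_norm_vec ((1\<^sub>m n - cis y \<cdot>\<^sub>m \<Psi>) ^\<^sub>m p *\<^sub>v v)"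
  using assms by (intro norm_pow_attains_INF[where n = n]) (auto intro!: continuous_intros)

lemma FCF_TAP_min:
  assumes "\<Psi> \<in> carrier_mat n n" and "B \<in> carrier_mat n n" and "v \<in> carrier_vec n"
  shows "\<exists>y \<in> {0..2 * pi}.
    (INF x \<in> {0..2 * pi}. l2_norm_vec ((B * (1\<^sub>m n - cis x \<cdot>\<^sub>m \<Psi>)) ^\<^sub>m p *\<^sub>v v)) =
      l2_norm_vec ((B * (1\<^sub>m n - cis y \<cdot>\<^sub>m \<Psi>)) ^\<^sub>m p *\<^sub>v v)"
  using assms
  by (intro norm_pow_attains_INF[where n = n])
     (auto simp: scalar_prod_def intro!: continuous_intros)

definition is_min_constant :: "(real \<Rightarrow> bool) \<Rightarrow> real \<Rightarrow> bool" where
  "is_min_constant P c \<longleftrightarrow> P c \<and> (\<forall>c'. P c' \<longrightarrow> c \<le> c')"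

text \<open>\<open>f N \<ge> c / (1 + O(1 / \<surd>N))\<close> as \<open>N \<rightarrow> \<infinity>\<close>, with a nonnegative \<open>O\<close>-term. The inequality can
  only be asked for large \<open>N\<close>: the error propagation matrices are nilpotent, so the \<open>p\<close>-th power
  vanishes for small \<open>N\<close>.\<close>

definition asymp_lower_bound :: "(nat \<Rightarrow> real) \<Rightarrow> real \<Rightarrow> bool" where
  "asymp_lower_bound f c \<longleftrightarrow> (\<exists>\<epsilon> :: nat \<Rightarrow> real.
     (\<forall>N. \<epsilon> N \<ge> 0) \<and> \<epsilon> \<in> O(\<lambda>N. 1 / sqrt (real N)) \<and>
     (\<forall>\<^sub>F N in sequentially. f N \<ge> c / (1 + \<epsilon> N)))"

end

theory Submission
  imports Defs "Jordan_Normal_Form.Determinant"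
begin

text \<open>Both error propagation matrices factor through \<open>B_Delta\<close>: on the stack of blocks
  \<open>Q (U\<^sub>j - \<Psi> U\<^sub>j\<^sub>-\<^sub>1)\<close> the matrix returns the blocks \<open>(\<Phi>\<^sup>k - \<Psi>) U\<^sub>j\<^sub>-\<^sub>s\<close>, where \<open>Q = I\<close>, \<open>s = 1\<close>
  for F-relaxation and \<open>Q = \<Phi>\<^sup>-\<^sup>k\<close>, \<open>s = 2\<close> for FCF-relaxation. In the commuting case this can be
  iterated. Start from the geometric sequence \<open>U\<^sub>j = cis (- j x) v\<close>. All but the first \<open>p\<close> blocks
  of the input have the norm of \<open>(Q (I - cis x \<Psi>))\<^sup>p v\<close>, and all but the first \<open>s p\<close> blocks of the
  output have the norm of \<open>(\<Phi>\<^sup>k - \<Psi>)\<^sup>p v\<close>. A power of \<open>\<Psi>\<close> is a contraction, so \<open>v\<close>, and with it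
  the first \<open>p\<close> input blocks, is bounded by \<open>(Q (I - cis x \<Psi>))\<^sup>p v\<close> uniformly in \<open>x\<close> and \<open>v\<close>. Hence
  the norm of the \<open>p\<close>-th power times \<open>1 + O(1/N)\<close> is an admissible constant in the temporal
  approximation property, and therefore at least the minimal one.\<close>

subsection \<open>Euclidean norms\<close>

lemma l2_norm_vec_nonneg [simp]: "0 \<le> l2_norm_vec v"
  by (simp add: l2_norm_vec_def)

lemma l2_norm_vec_square: "(l2_norm_vec v)\<^sup>2 = (\<Sum>i<dim_vec v. (cmod (v $ i))\<^sup>2)"
  by (simp add: l2_norm_vec_def L2_set_def sum_nonneg)

lemma l2_norm_vec_zero [simp]: "l2_norm_vec (0\<^sub>v n) = 0"
  by (simp add: l2_norm_vec_def L2_set_def)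

lemma l2_norm_vec_eq_0_iff: "l2_norm_vec v = 0 \<longleftrightarrow> v = 0\<^sub>v (dim_vec v)"
  by (auto simp: l2_norm_vec_def L2_set_eq_0_iff intro!: eq_vecI)
    (metis index_zero_vec(1))

lemma l2_norm_vec_smult: "l2_norm_vec (c \<cdot>\<^sub>v v) = cmod c * l2_norm_vec v"
  by (auto simp: l2_norm_vec_def norm_mult L2_set_right_distrib intro!: L2_set_cong)

lemma l2_norm_vec_uminus: "l2_norm_vec (- v) = l2_norm_vec v"
  by (auto simp: l2_norm_vec_def intro!: L2_set_cong)

lemma l2_norm_vec_add:
  assumes "v \<in> carrier_vec n" "w \<in> carrier_vec n"
  shows "l2_norm_vec (v + w) \<le> l2_norm_vec v + l2_norm_vec w"
proof -
  have "l2_norm_vec (v + w) \<le> L2_set (\<lambda>i. cmod (v $ i) + cmod (w $ i)) {..<n}"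
    using assms by (auto simp: l2_norm_vec_def intro!: L2_set_mono norm_triangle_ineq)
  also have "\<dots> \<le> l2_norm_vec v + l2_norm_vec w"
    using assms L2_set_triangle_ineq by (auto simp: l2_norm_vec_def)
  finally show ?thesis .
qed

lemma l2_norm_vec_diff:
  assumes "v \<in> carrier_vec n" "w \<in> carrier_vec n"
  shows "l2_norm_vec (v - w) \<le> l2_norm_vec v + l2_norm_vec w"
  using l2_norm_vec_add[of v n "- w"] assms
  by (simp add: minus_add_uminus_vec[of _ n] l2_norm_vec_uminus)

text \<open>The supremum in \<open>l2_norm_mat\<close> says something about \<open>A\<close> only if
  the quotients are bounded. A crude \<open>K\<close>, the sum of the moduli of all entries, is
  enough for that.\<close>

lemma mult_mat_vec_bounded:
  "\<exists>K. \<forall>v \<in> carrier_vec (dim_col A). l2_norm_vec (A *\<^sub>v v) \<le> K * l2_norm_vec v"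
proof (intro exI ballI)
  fix v :: "complex vec" assume v: "v \<in> carrier_vec (dim_col A)"
  have "l2_norm_vec (A *\<^sub>v v) \<le> (\<Sum>i<dim_row A. cmod ((A *\<^sub>v v) $ i))"
    unfolding l2_norm_vec_def dim_mult_mat_vec by (intro L2_set_le_sum) simp
  also have "\<dots> \<le> (\<Sum>i<dim_row A. (\<Sum>j<dim_col A. cmod (A $$ (i, j))) * l2_norm_vec v)"
  proof (rule sum_mono)
    fix i assume i: "i \<in> {..<dim_row A}"
    then have "(A *\<^sub>v v) $ i = (\<Sum>j<dim_col A. A $$ (i, j) * v $ j)"
      using v by (auto simp: scalar_prod_def lessThan_atLeast0)
    also have "cmod \<dots> \<le> (\<Sum>j<dim_col A. cmod (A $$ (i, j)) * cmod (v $ j))"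
      by (rule order_trans[OF norm_sum]) (simp add: norm_mult)
    also have "\<dots> \<le> (\<Sum>j<dim_col A. cmod (A $$ (i, j)) * l2_norm_vec v)"
      using v by (intro sum_mono mult_left_mono)
        (auto simp: l2_norm_vec_def intro!: member_le_L2_set)
    finally show "cmod ((A *\<^sub>v v) $ i) \<le> (\<Sum>j<dim_col A. cmod (A $$ (i, j))) * l2_norm_vec v"
      by (simp add: sum_distrib_right)
  qed
  finally show "l2_norm_vec (A *\<^sub>v v) \<le>
      (\<Sum>i<dim_row A. \<Sum>j<dim_col A. cmod (A $$ (i, j))) * l2_norm_vec v"
    by (simp add: sum_distrib_right)
qed

lemma l2_norm_vec_quotient_le_l2_norm_mat:
  assumes v: "v \<in> carrier_vec (dim_col A)" "v \<noteq> 0\<^sub>v (dim_col A)"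
  shows "l2_norm_vec (A *\<^sub>v v) / l2_norm_vec v \<le> l2_norm_mat A"
  unfolding l2_norm_mat_def
proof (rule cSUP_upper)
  obtain K where K: "\<And>v. v \<in> carrier_vec (dim_col A) \<Longrightarrow>
      l2_norm_vec (A *\<^sub>v v) \<le> K * l2_norm_vec v"
    using mult_mat_vec_bounded by blast
  show "bdd_above ((\<lambda>v. l2_norm_vec (A *\<^sub>v v) / l2_norm_vec v) `
      (carrier_vec (dim_col A) - {0\<^sub>v (dim_col A)}))"
  proof (rule bdd_aboveI2)
    fix w :: "complex vec"
    assume w: "w \<in> carrier_vec (dim_col A) - {0\<^sub>v (dim_col A)}"
    then have "l2_norm_vec w \<noteq> 0"
      by (auto simp: l2_norm_vec_eq_0_iff)
    then have "0 < l2_norm_vec w"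
      using l2_norm_vec_nonneg[of w] by linarith
    then show "l2_norm_vec (A *\<^sub>v w) / l2_norm_vec w \<le> K"
      using K[of w] w by (simp add: divide_le_eq)
  qed
qed (use v in auto)

lemma l2_norm_mat_mult_vec:
  assumes "v \<in> carrier_vec (dim_col A)"
  shows "l2_norm_vec (A *\<^sub>v v) \<le> l2_norm_mat A * l2_norm_vec v"
proof (cases "v = 0\<^sub>v (dim_col A)")
  case True
  then have "A *\<^sub>v v = 0\<^sub>v (dim_row A)"
    by (auto intro!: eq_vecI simp: scalar_prod_def)
  with True show ?thesis by simp
next
  case False
  with assms have "l2_norm_vec v \<noteq> 0"
    by (auto simp: l2_norm_vec_eq_0_iff)
  then have "0 < l2_norm_vec v"
    using l2_norm_vec_nonneg[of v] by linarith
  then show ?thesis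
    using l2_norm_vec_quotient_le_l2_norm_mat[OF assms False] by (simp add: divide_le_eq)
qed

text \<open>With at least one column, a unit vector supplies a nonnegative quotient below the
  supremum. Without columns the supremum would range over the empty set.\<close>

lemma l2_norm_mat_nonneg:
  assumes "0 < dim_col A"
  shows "0 \<le> l2_norm_mat A"
proof -
  have "unit_vec (dim_col A) 0 \<noteq> 0\<^sub>v (dim_col A)"
    using assms by (metis index_unit_vec(1) index_zero_vec(1) zero_neq_one)
  then have "l2_norm_vec (A *\<^sub>v unit_vec (dim_col A) 0) / l2_norm_vec (unit_vec (dim_col A) 0)
      \<le> l2_norm_mat A"
    by (intro l2_norm_vec_quotient_le_l2_norm_mat) auto
  then show ?thesis
    by (rule order_trans[rotated]) simp
qed

text \<open>The temporal approximation properties speak of \<Psi> minus the power of \<Phi>, whereas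
  the error matrices produce the negative of it. The resulting sign \<open>(- 1) ^ m\<close> is
  invisible to the norm.\<close>

lemma l2_norm_vec_uminus_pow:
  assumes D: "D \<in> carrier_mat n n" and v: "v \<in> carrier_vec n"
  shows "l2_norm_vec ((- D) ^\<^sub>m m *\<^sub>v v) = l2_norm_vec (D ^\<^sub>m m *\<^sub>v v)"
  using v
proof (induction m arbitrary: v)
  case 0
  then show ?case using D by simp
next
  case (Suc m)
  have P: "D ^\<^sub>m m \<in> carrier_mat n n" "(- D) ^\<^sub>m m \<in> carrier_mat n n"
    using D by auto
  have "(- D) ^\<^sub>m Suc m *\<^sub>v v = (- D) ^\<^sub>m m *\<^sub>v (- (D *\<^sub>v v))"
    unfolding pow_mat.simps using D P Suc.prems by (subst assoc_mult_mat_vec[of _ n n _ n]) auto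
  also have "l2_norm_vec \<dots> = l2_norm_vec (D ^\<^sub>m m *\<^sub>v (- (D *\<^sub>v v)))"
    using D Suc.prems by (intro Suc.IH) auto
  also have "- (D *\<^sub>v v) = (- 1) \<cdot>\<^sub>v (D *\<^sub>v v)"
    by (intro eq_vecI) auto
  also have "D ^\<^sub>m m *\<^sub>v ((- 1) \<cdot>\<^sub>v (D *\<^sub>v v)) = (- 1) \<cdot>\<^sub>v (D ^\<^sub>m Suc m *\<^sub>v v)"
    using D P Suc.prems
    by (simp add: assoc_mult_mat_vec[of _ n n _ n] mult_mat_vec[of _ n n])
  finally show ?case by (simp add: l2_norm_vec_smult)
qed

section \<open>Bounding a vector by its image, uniformly in the phase\<close>

text \<open>A truncated Neumann series: for \<open>u = (I - cis x \<Psi>) v\<close> one has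
  \<open>v = u + cis x \<Psi> v\<close>, and \<open>q\<close> substitutions bound \<open>v\<close>
  by a multiple of \<open>u\<close> plus the norm of \<open>\<Psi> ^\<^sub>m q *\<^sub>v v\<close>.
  Since the \<open>q\<close>-th power is a contraction, this remainder is absorbed on the left.
  \<open>K\<close> does not depend on \<open>x\<close> because \<open>cis x\<close> has modulus
  1.\<close>

lemma vec_le_resolvent:
  assumes n: "0 < n" and \<Psi>: "\<Psi> \<in> carrier_mat n n" and q: "l2_norm_mat (\<Psi> ^\<^sub>m q) < 1"
  obtains K where "0 \<le> K"
    "\<And>x v. v \<in> carrier_vec n \<Longrightarrow> l2_norm_vec v \<le> K * l2_norm_vec ((1\<^sub>m n - cis x \<cdot>\<^sub>m \<Psi>) *\<^sub>v v)"
proof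
  let ?S = "\<Sum>j<q. l2_norm_mat (\<Psi> ^\<^sub>m j)"
  have pow: "\<Psi> ^\<^sub>m j \<in> carrier_mat n n" for j
    using \<Psi> by simp
  have "0 \<le> ?S"
    using n \<Psi> by (intro sum_nonneg l2_norm_mat_nonneg) simp
  then show "0 \<le> ?S / (1 - l2_norm_mat (\<Psi> ^\<^sub>m q))"
    using q by simp
  fix x and v :: "complex vec"
  assume v: "v \<in> carrier_vec n"
  let ?u = "(1\<^sub>m n - cis x \<cdot>\<^sub>m \<Psi>) *\<^sub>v v"
  have u: "?u \<in> carrier_vec n"
    using \<Psi> v by (auto intro!: mult_mat_vec_carrier[of _ n n])
  have "(cis x \<cdot>\<^sub>m \<Psi>) *\<^sub>v v = cis x \<cdot>\<^sub>v (\<Psi> *\<^sub>v v)"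
    using \<Psi> v by (auto intro!: eq_vecI)
  then have u_eq: "?u = v - cis x \<cdot>\<^sub>v (\<Psi> *\<^sub>v v)"
    using \<Psi> v by (simp add: minus_mult_distrib_mat_vec[of _ n n])
  have v_eq: "v = ?u + cis x \<cdot>\<^sub>v (\<Psi> *\<^sub>v v)"
    unfolding u_eq using \<Psi> v by (intro eq_vecI) auto
  have telescope: "l2_norm_vec v \<le> (\<Sum>j<m. l2_norm_mat (\<Psi> ^\<^sub>m j)) * l2_norm_vec ?u
      + l2_norm_vec (\<Psi> ^\<^sub>m m *\<^sub>v v)" for m
  proof (induction m)
    case 0
    show ?case using \<Psi> v by simp
  next
    case (Suc m)
    have "\<Psi> ^\<^sub>m m *\<^sub>v v = \<Psi> ^\<^sub>m m *\<^sub>v (?u + cis x \<cdot>\<^sub>v (\<Psi> *\<^sub>v v))"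
      using v_eq by simp
    also have "\<dots> = \<Psi> ^\<^sub>m m *\<^sub>v ?u + cis x \<cdot>\<^sub>v (\<Psi> ^\<^sub>m Suc m *\<^sub>v v)"
      using \<Psi> v pow[of m] u
      by (simp add: mult_add_distrib_mat_vec[OF pow] mult_mat_vec[OF pow]
          assoc_mult_mat_vec[OF pow \<Psi> v])
    finally have "l2_norm_vec (\<Psi> ^\<^sub>m m *\<^sub>v v) \<le> l2_norm_vec (\<Psi> ^\<^sub>m m *\<^sub>v ?u)
        + l2_norm_vec (cis x \<cdot>\<^sub>v (\<Psi> ^\<^sub>m Suc m *\<^sub>v v))"
      using pow[of m] pow[of "Suc m"] u v
      by (metis l2_norm_vec_add mult_mat_vec_carrier smult_carrier_vec)
    also have "\<dots> \<le> l2_norm_mat (\<Psi> ^\<^sub>m m) * l2_norm_vec ?u + l2_norm_vec (\<Psi> ^\<^sub>m Suc m *\<^sub>v v)"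
      using l2_norm_mat_mult_vec[of ?u "\<Psi> ^\<^sub>m m"] u \<Psi> by (simp add: l2_norm_vec_smult)
    finally show ?case
      using Suc.IH by (simp add: algebra_simps)
  qed
  have "l2_norm_vec (\<Psi> ^\<^sub>m q *\<^sub>v v) \<le> l2_norm_mat (\<Psi> ^\<^sub>m q) * l2_norm_vec v"
    using \<Psi> v by (intro l2_norm_mat_mult_vec) simp
  with telescope[of q] have "(1 - l2_norm_mat (\<Psi> ^\<^sub>m q)) * l2_norm_vec v \<le> ?S * l2_norm_vec ?u"
    by (simp add: algebra_simps)
  then show "l2_norm_vec v \<le> ?S / (1 - l2_norm_mat (\<Psi> ^\<^sub>m q)) * l2_norm_vec ?u"
    using q by (simp add: field_simps)
qed

text \<open>The bound is applied successively to \<open>v\<close>, \<open>P v\<close>,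
  \<open>P (P v)\<close> and so on, each time at the cost of a factor \<open>K\<close>.\<close>

lemma vec_le_pow_mult_vec:
  assumes P: "P \<in> carrier_mat n n" and K: "0 \<le> K"
    and le: "\<And>v. v \<in> carrier_vec n \<Longrightarrow> l2_norm_vec v \<le> K * l2_norm_vec (P *\<^sub>v v)"
    and v: "v \<in> carrier_vec n"
  shows "l2_norm_vec v \<le> K ^ m * l2_norm_vec (P ^\<^sub>m m *\<^sub>v v)"
  using v
proof (induction m arbitrary: v)
  case 0
  then show ?case using P by simp
next
  case (Suc m)
  have "l2_norm_vec v \<le> K * l2_norm_vec (P *\<^sub>v v)"
    using Suc.prems by (rule le)
  also have "\<dots> \<le> K * (K ^ m * l2_norm_vec (P ^\<^sub>m m *\<^sub>v (P *\<^sub>v v)))"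
    using P K Suc by (intro mult_left_mono Suc.IH) auto
  finally show ?case
    using P Suc.prems by (simp add: assoc_mult_mat_vec[of _ n n _ n])
qed

subsection \<open>Block vectors\<close>

lemma sum_lessThan_mult:
  "(\<Sum>r<N * n. f r) = (\<Sum>i<N. \<Sum>l<n. f (i * n + l))" for f :: "nat \<Rightarrow> 'a::comm_monoid_add"
proof -
  have "(\<Sum>r<N * n. f r) = (\<Sum>i<N. sum f {i * n..<i * n + n})"
    by (rule sum.nat_group[symmetric])
  also have "\<dots> = (\<Sum>i<N. \<Sum>l<n. f (i * n + l))"
  proof (rule sum.cong)
    fix i
    show "sum f {i * n..<i * n + n} = (\<Sum>l<n. f (i * n + l))"
      using sum.shift_bounds_nat_ivl[of f 0 "i * n" n]
      by (simp add: lessThan_atLeast0 add.commute)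
  qed simp
  finally show ?thesis .
qed

lemma block_index_less:
  assumes "i < N" "l < n"
  shows "i * n + l < N * (n::nat)"
proof -
  have "i * n + l < Suc i * n"
    using assms by simp
  also have "\<dots> \<le> N * n"
    using assms by (intro mult_le_mono1) simp
  finally show ?thesis .
qed

text \<open>The blocks come from an infinite sequence, indexed as in \<open>block_matrix\<close>.
  Operators can thus be studied on sequences independently of \<open>N\<close>, which enters only by
  truncation.\<close>

definition stack :: "nat \<Rightarrow> nat \<Rightarrow> (nat \<Rightarrow> complex vec) \<Rightarrow> complex vec" where
  "stack N n U = vec (N * n) (\<lambda>r. U (r div n) $ (r mod n))"

lemma stack_carrier [simp]: "stack N n U \<in> carrier_vec (N * n)"
  by (simp add: stack_def)

lemma dim_stack [simp]: "dim_vec (stack N n U) = N * n"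
  by (simp add: stack_def)

lemma l2_norm_vec_stack:
  assumes "\<And>j. U j \<in> carrier_vec n"
  shows "(l2_norm_vec (stack N n U))\<^sup>2 = (\<Sum>j<N. (l2_norm_vec (U j))\<^sup>2)"
proof -
  have "i * n + l < N * n" if "i < N" "l < n" for i l
    using that by (rule block_index_less)
  moreover have "dim_vec (U j) = n" for j
    using assms[of j] by simp
  ultimately show ?thesis
    by (auto simp: l2_norm_vec_square sum_lessThan_mult stack_def intro!: sum.cong)
qed

text \<open>The zero block at index 0 stands for the missing subdiagonal block in the first block
  row. It causes all the boundary effects that the error term has to absorb.\<close>

definition shift :: "nat \<Rightarrow> (nat \<Rightarrow> complex vec) \<Rightarrow> nat \<Rightarrow> complex vec" where
  "shift n U j = (case j of 0 \<Rightarrow> 0\<^sub>v n | Suc i \<Rightarrow> U i)"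

lemma shift_simps [simp]: "shift n U 0 = 0\<^sub>v n" "shift n U (Suc i) = U i"
  by (simp_all add: shift_def)

lemma shift_carrier [simp]: "(\<And>j. U j \<in> carrier_vec n) \<Longrightarrow> shift n U j \<in> carrier_vec n"
  by (cases j) auto

lemma subdiag_matrix_carrier:
  assumes "D \<in> carrier_mat n n"
  shows "subdiag_matrix N D S \<in> carrier_mat (N * n) (N * n)"
  using assms by (simp add: subdiag_matrix_def block_matrix_def)

text \<open>Block row \<open>i\<close> meets only the blocks \<open>i\<close> and
  \<open>i - 1\<close> of the vector. This replaces block matrix computations by recurrences on
  sequences.\<close>

lemma subdiag_matrix_mult_stack:
  assumes D: "D \<in> carrier_mat n n" and S: "S \<in> carrier_mat n n"
    and U: "\<And>j. U j \<in> carrier_vec n"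
  shows "subdiag_matrix N D S *\<^sub>v stack N n U = stack N n (\<lambda>j. D *\<^sub>v U j + S *\<^sub>v shift n U j)"
proof (rule eq_vecI)
  let ?B = "\<lambda>i j. if i = j then D else if i = Suc j then S else 0\<^sub>m n n"
  fix r assume "r < dim_vec (stack N n (\<lambda>j. D *\<^sub>v U j + S *\<^sub>v shift n U j))"
  then have r: "r < N * n" by simp
  define i l where "i = r div n" and "l = r mod n"
  have n: "0 < n" using r by (cases n) auto
  have i: "i < N" using r by (simp add: i_def less_mult_imp_div_less)
  have l: "l < n" using n by (simp add: l_def)
  have dim: "dim_vec (U j) = n" "dim_row D = n" "dim_col D = n" "dim_row S = n" "dim_col S = n" for j
    using U[of j] D S by auto
  have bound: "j * n + m < N * n" if "j < N" "m < n" for j m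
    using that by (rule block_index_less)
  have "(subdiag_matrix N D S *\<^sub>v stack N n U) $ r
      = (\<Sum>c<N * n. ?B i (c div n) $$ (l, c mod n) * U (c div n) $ (c mod n))"
    using r by (auto simp: subdiag_matrix_def block_matrix_def stack_def scalar_prod_def dim
        i_def l_def lessThan_atLeast0 intro!: sum.cong)
  also have "\<dots> = (\<Sum>j<N. \<Sum>m<n. ?B i j $$ (l, m) * U j $ m)"
    by (auto simp: sum_lessThan_mult intro!: sum.cong)
  also have "\<dots> = (\<Sum>j<N. (?B i j *\<^sub>v U j) $ l)"
    using l by (intro sum.cong) (auto simp: scalar_prod_def dim lessThan_atLeast0)
  also have "\<dots> = (\<Sum>j<N. (if j = i then (D *\<^sub>v U j) $ l else 0)
      + (if Suc j = i then (S *\<^sub>v U j) $ l else 0))"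
    using l by (intro sum.cong) (auto simp: dim scalar_prod_def)
  also have "\<dots> = (D *\<^sub>v U i) $ l + (\<Sum>j<N. if Suc j = i then (S *\<^sub>v U j) $ l else 0)"
    using i by (simp add: sum.distrib)
  also have "(\<Sum>j<N. if Suc j = i then (S *\<^sub>v U j) $ l else 0) = (S *\<^sub>v shift n U i) $ l"
  proof (cases i)
    case 0
    then show ?thesis using l by (simp add: dim scalar_prod_def)
  next
    case (Suc i')
    then show ?thesis using i by simp
  qed
  finally show "(subdiag_matrix N D S *\<^sub>v stack N n U) $ r
      = stack N n (\<lambda>j. D *\<^sub>v U j + S *\<^sub>v shift n U j) $ r"
    using r l by (simp add: stack_def dim i_def l_def)
qed (use D in \<open>simp add: subdiag_matrix_def block_matrix_def\<close>)

section \<open>Invertibility through determinants\<close>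

lemma invertible_mat_iff_det:
  assumes A: "(A :: complex mat) \<in> carrier_mat n n"
  shows "invertible_mat A \<longleftrightarrow> det A \<noteq> 0"
proof
  assume "invertible_mat A"
  from mat_inv[OF A this] have "det A * det (mat_inv A) = 1"
    using det_mult[OF A] by (metis det_one)
  then show "det A \<noteq> 0" by auto
next
  assume "det A \<noteq> 0"
  from det_non_zero_imp_unit[OF A this, of "()"] obtain B where
    "B \<in> carrier_mat n n" "A * B = 1\<^sub>m n" "B * A = 1\<^sub>m n"
    by (auto simp: Units_def ring_mat_simps)
  with A show "invertible_mat A"
    unfolding invertible_mat_def inverts_mat_def by (auto intro!: exI[of _ B])
qed

lemma invertible_mat_pow:
  assumes A: "(A :: complex mat) \<in> carrier_mat n n" and inv: "invertible_mat A"
  shows "invertible_mat (A ^\<^sub>m m)"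
proof -
  have "det (A ^\<^sub>m m) = det A ^ m"
    using A by (induction m) (auto simp: det_mult[of _ n])
  then show ?thesis
    using A inv by (simp add: invertible_mat_iff_det[of _ n])
qed

text \<open>The matrix is lower triangular with ones on the diagonal, so its determinant is 1,
  whatever \<Psi> is.\<close>

lemma invertible_B_Delta:
  assumes \<Psi>: "\<Psi> \<in> carrier_mat n n"
  shows "invertible_mat (B_Delta \<Psi> N)"
proof -
  have c: "B_Delta \<Psi> N \<in> carrier_mat (N * n) (N * n)"
    using \<Psi> by (simp add: B_Delta_def subdiag_matrix_carrier)
  have n: "0 < n" if "j < N * n" for j
    using that by (cases n) auto
  have "B_Delta \<Psi> N $$ (i, j) = 0" if ij: "i < j" "j < N * n" for i j
  proof -
    \<comment> \<open>An entry above the diagonal lies either in a block above the block diagonal,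
      which is zero, or off the diagonal of an identity block.\<close>
    have "i div n \<le> j div n"
      using ij by (simp add: div_le_mono)
    moreover have "i mod n \<noteq> j mod n" if "i div n = j div n"
      using ij that by (metis div_mod_decomp less_irrefl)
    ultimately show ?thesis
      using ij n[of j] \<Psi> by (auto simp: B_Delta_def subdiag_matrix_def block_matrix_def)
  qed
  then have "det (B_Delta \<Psi> N) = prod_list (diag_mat (B_Delta \<Psi> N))"
    using c by (rule det_lower_triangular)
  also have "\<dots> = 1"
    using c \<Psi> n unfolding prod_list_diag_prod
    by (auto intro!: prod.neutral simp: B_Delta_def subdiag_matrix_def block_matrix_def)
  finally show ?thesis
    using c by (simp add: invertible_mat_iff_det)
qed

section \<open>Shifts of block sequences\<close>

lemma shift_pow_add: "(shift n ^^ s) U (j + s) = U j"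
  by (induction s) auto

lemma shift_pow_carrier [simp]:
  "(\<And>j. U j \<in> carrier_vec n) \<Longrightarrow> (shift n ^^ s) U j \<in> carrier_vec n"
  by (induction s arbitrary: j) auto

lemma shift_mult_mat_vec:
  assumes "A \<in> carrier_mat n n" and "\<And>j. U j \<in> carrier_vec n"
  shows "shift n (\<lambda>j. A *\<^sub>v U j) = (\<lambda>j. A *\<^sub>v shift n U j)"
proof
  fix j
  show "shift n (\<lambda>j. A *\<^sub>v U j) j = A *\<^sub>v shift n U j"
    using assms by (cases j) (auto intro!: eq_vecI simp: scalar_prod_def)
qed

subsection \<open>The test vectors\<close>

definition bidiag :: "nat \<Rightarrow> complex mat \<Rightarrow> complex mat \<Rightarrow> (nat \<Rightarrow> complex vec) \<Rightarrow> nat \<Rightarrow> complex vec" where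
  "bidiag n Q \<Psi> U j = Q *\<^sub>v (U j - \<Psi> *\<^sub>v shift n U j)"

text \<open>On stacks this is the block matrix with \<open>D\<close> on the \<open>s\<close>-th
  block subdiagonal and zeros elsewhere.\<close>

definition delay :: "nat \<Rightarrow> nat \<Rightarrow> complex mat \<Rightarrow> (nat \<Rightarrow> complex vec) \<Rightarrow> nat \<Rightarrow> complex vec" where
  "delay n s D U j = D *\<^sub>v (shift n ^^ s) U j"

context
  fixes n :: nat and Q \<Psi> D :: "complex mat"
  assumes Q: "Q \<in> carrier_mat n n" and \<Psi>: "\<Psi> \<in> carrier_mat n n" and D: "D \<in> carrier_mat n n"
begin

lemma bidiag_carrier [simp]:
  "(\<And>j. U j \<in> carrier_vec n) \<Longrightarrow> bidiag n Q \<Psi> U j \<in> carrier_vec n"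
  unfolding bidiag_def using Q \<Psi>
  by (intro mult_mat_vec_carrier[of _ n n] minus_carrier_vec) auto

lemma delay_carrier [simp]:
  "(\<And>j. U j \<in> carrier_vec n) \<Longrightarrow> delay n s D U j \<in> carrier_vec n"
  unfolding delay_def using D by (intro mult_mat_vec_carrier[of _ n n]) auto

lemma bidiag_pow_carrier [simp]:
  "(\<And>j. U j \<in> carrier_vec n) \<Longrightarrow> (bidiag n Q \<Psi> ^^ m) U j \<in> carrier_vec n"
  by (induction m arbitrary: j) auto

lemma delay_pow_carrier [simp]:
  "(\<And>j. U j \<in> carrier_vec n) \<Longrightarrow> (delay n s D ^^ m) U j \<in> carrier_vec n"
  by (induction m arbitrary: j) auto

lemma shift_bidiag:
  assumes U: "\<And>j. U j \<in> carrier_vec n"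
  shows "shift n (bidiag n Q \<Psi> U) = bidiag n Q \<Psi> (shift n U)"
proof
  fix j
  show "shift n (bidiag n Q \<Psi> U) j = bidiag n Q \<Psi> (shift n U) j"
    using U Q \<Psi> by (cases j) (auto intro!: eq_vecI simp: scalar_prod_def bidiag_def)
qed

lemma shift_pow_bidiag:
  assumes U: "\<And>j. U j \<in> carrier_vec n"
  shows "(shift n ^^ s) (bidiag n Q \<Psi> U) = bidiag n Q \<Psi> ((shift n ^^ s) U)"
  using U by (induction s) (auto simp: shift_bidiag)

text \<open>Shifts commute with every operator that acts in the same way on each block and fixes
  zero; what remains is to move \<open>D\<close> past \<open>Q\<close> and \<Psi>. This is where the
  commuting hypothesis enters.\<close>

lemma delay_bidiag:
  assumes U: "\<And>j. U j \<in> carrier_vec n"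
    and QD: "Q * D = D * Q" and \<Psi>D: "\<Psi> * D = D * \<Psi>"
  shows "delay n s D (bidiag n Q \<Psi> U) = bidiag n Q \<Psi> (delay n s D U)"
proof
  fix j
  define X where "X = (shift n ^^ s) U"
  have X: "X i \<in> carrier_vec n" "shift n X i \<in> carrier_vec n" for i
    using U by (auto simp: X_def)
  have "delay n s D (bidiag n Q \<Psi> U) j = D *\<^sub>v (Q *\<^sub>v (X j - \<Psi> *\<^sub>v shift n X j))"
    using U by (simp add: delay_def shift_pow_bidiag bidiag_def X_def)
  also have "\<dots> = (D * Q) *\<^sub>v (X j - \<Psi> *\<^sub>v shift n X j)"
    using D Q \<Psi> X by (intro assoc_mult_mat_vec[symmetric, of _ n n _ n])
      (auto intro!: minus_carrier_vec mult_mat_vec_carrier[of _ n n])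
  also have "\<dots> = Q *\<^sub>v (D *\<^sub>v (X j - \<Psi> *\<^sub>v shift n X j))"
    unfolding QD[symmetric] using D Q \<Psi> X by (intro assoc_mult_mat_vec[of _ n n _ n])
      (auto intro!: minus_carrier_vec mult_mat_vec_carrier[of _ n n])
  also have "D *\<^sub>v (X j - \<Psi> *\<^sub>v shift n X j) = D *\<^sub>v X j - (D * \<Psi>) *\<^sub>v shift n X j"
    using D \<Psi> X by (simp add: mult_minus_distrib_mat_vec[of _ n n] mult_mat_vec_carrier[of _ n n]
        assoc_mult_mat_vec[of _ n n _ n])
  also have "\<dots> = D *\<^sub>v X j - \<Psi> *\<^sub>v (D *\<^sub>v shift n X j)"
    unfolding \<Psi>D[symmetric] using D \<Psi> X by (simp add: assoc_mult_mat_vec[of _ n n _ n])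
  also have "D *\<^sub>v shift n X j = shift n (delay n s D U) j"
    using D X by (simp add: delay_def[abs_def] X_def[symmetric] shift_mult_mat_vec)
  finally show "delay n s D (bidiag n Q \<Psi> U) j = bidiag n Q \<Psi> (delay n s D U) j"
    by (simp add: bidiag_def[of n Q \<Psi> "delay n s D U"] delay_def X_def)
qed

lemma delay_bidiag_pow:
  assumes U: "\<And>j. U j \<in> carrier_vec n"
    and "Q * D = D * Q" and "\<Psi> * D = D * \<Psi>"
  shows "delay n s D ((bidiag n Q \<Psi> ^^ m) U) = (bidiag n Q \<Psi> ^^ m) (delay n s D U)"
  using U by (induction m) (auto simp: delay_bidiag assms(2,3))

text \<open>Each application multiplies by \<open>D\<close> and moves the blocks by
  \<open>s\<close>, so from index \<open>s * m\<close> on none of the zeros fed in at the front is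
  visible.\<close>

lemma delay_pow_add:
  assumes "\<And>j. U j \<in> carrier_vec n"
  shows "(delay n s D ^^ m) U (j + s * m) = D ^\<^sub>m m *\<^sub>v U j"
  using assms
proof (induction m arbitrary: U j)
  case 0
  then show ?case using D by simp
next
  case (Suc m)
  have "(delay n s D ^^ Suc m) U (j + s * Suc m) = (delay n s D ^^ m) (delay n s D U) (j + s + s * m)"
    by (simp add: funpow_swap1 add.assoc)
  also have "\<dots> = D ^\<^sub>m m *\<^sub>v delay n s D U (j + s)"
    using Suc.prems by (intro Suc.IH) auto
  also have "\<dots> = D ^\<^sub>m Suc m *\<^sub>v U j"
    using D Suc.prems[of j]
    by (simp add: delay_def shift_pow_add assoc_mult_mat_vec[of _ n n _ n])
  finally show ?case .
qed

text \<open>On a geometric sequence the preceding block is \<open>cis x\<close> times the current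
  one, so \<open>bidiag\<close> acts as the fixed matrix
  \<open>Q * (1\<^sub>m n - cis x \<cdot>\<^sub>m \<Psi>)\<close>. It looks one block back, hence
  every application spoils one more block at the front; the start index \<open>i\<close> is kept
  general so that the induction can advance it.\<close>

lemma bidiag_pow_geometric:
  assumes "\<And>j. U j \<in> carrier_vec n" and "w \<in> carrier_vec n"
    and "\<And>j. i \<le> j \<Longrightarrow> U j = cis (- (real j * x)) \<cdot>\<^sub>v w"
    and "i + m \<le> j"
  shows "(bidiag n Q \<Psi> ^^ m) U j
    = cis (- (real j * x)) \<cdot>\<^sub>v ((Q * (1\<^sub>m n - cis x \<cdot>\<^sub>m \<Psi>)) ^\<^sub>m m *\<^sub>v w)"
  using assms
proof (induction m arbitrary: U w i)
  case 0
  then show ?case using Q by simp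
next
  case (Suc m)
  let ?P = "Q * (1\<^sub>m n - cis x \<cdot>\<^sub>m \<Psi>)"
  have c: "1\<^sub>m n - cis x \<cdot>\<^sub>m \<Psi> \<in> carrier_mat n n"
    using \<Psi> by (intro minus_carrier_mat smult_carrier_mat)
  have P: "?P \<in> carrier_mat n n"
    using Q c by simp
  have step: "bidiag n Q \<Psi> U j = cis (- (real j * x)) \<cdot>\<^sub>v (?P *\<^sub>v w)" if j: "Suc i \<le> j" for j
  proof -
    obtain l where l: "j = Suc l" "i \<le> l"
      using j by (cases j) auto
    have "cis (- (real l * x)) = cis (- (real j * x)) * cis x"
      by (simp add: cis_mult l(1) algebra_simps)
    then have "U j - \<Psi> *\<^sub>v shift n U j
        = cis (- (real j * x)) \<cdot>\<^sub>v w - \<Psi> *\<^sub>v (cis (- (real j * x)) * cis x \<cdot>\<^sub>v w)"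
      using Suc.prems(3)[of j] Suc.prems(3)[of l] l by simp
    also have "\<dots> = cis (- (real j * x)) \<cdot>\<^sub>v ((1\<^sub>m n - cis x \<cdot>\<^sub>m \<Psi>) *\<^sub>v w)"
      unfolding mult_mat_vec[OF \<Psi> Suc.prems(2)] minus_mult_distrib_mat_vec[OF one_carrier_mat smult_carrier_mat[OF \<Psi>] Suc.prems(2)]
      using \<Psi> Suc.prems(2) by (intro eq_vecI) (auto simp: algebra_simps)
    finally show ?thesis
      using Q c Suc.prems(2)
      by (simp add: bidiag_def mult_mat_vec[OF Q] mult_mat_vec_carrier[OF c] assoc_mult_mat_vec[OF Q c])
  qed
  have "(bidiag n Q \<Psi> ^^ Suc m) U j = (bidiag n Q \<Psi> ^^ m) (bidiag n Q \<Psi> U) j"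
    by (simp add: funpow_swap1)
  also have "\<dots> = cis (- (real j * x)) \<cdot>\<^sub>v (?P ^\<^sub>m m *\<^sub>v (?P *\<^sub>v w))"
    using Suc.prems P step by (intro Suc.IH[where i = "Suc i"]) (auto intro: mult_mat_vec_carrier[OF P])
  finally show ?case
    using P Suc.prems(2) by (simp add: assoc_mult_mat_vec[of _ n n _ n])
qed

text \<open>Meant for the few front blocks that are no longer geometric: there a crude growth factor
  per application suffices.\<close>

lemma bidiag_pow_bounded:
  assumes U: "\<And>j. U j \<in> carrier_vec n" and R: "\<And>j. l2_norm_vec (U j) \<le> R" and n: "0 < n"
  shows "l2_norm_vec ((bidiag n Q \<Psi> ^^ m) U j) \<le> (l2_norm_mat Q * (1 + l2_norm_mat \<Psi>)) ^ m * R"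
proof (induction m arbitrary: j)
  case 0
  then show ?case using R by simp
next
  case (Suc m)
  define X where "X = (bidiag n Q \<Psi> ^^ m) U"
  define R' where "R' = (l2_norm_mat Q * (1 + l2_norm_mat \<Psi>)) ^ m * R"
  have X: "X j \<in> carrier_vec n" "shift n X j \<in> carrier_vec n" for j
    using U by (auto simp: X_def)
  have nonneg: "0 \<le> l2_norm_mat Q" "0 \<le> l2_norm_mat \<Psi>"
    using n Q \<Psi> by (auto intro!: l2_norm_mat_nonneg)
  have le: "l2_norm_vec (X j) \<le> R'" for j
    using Suc.IH by (simp add: X_def R'_def)
  \<comment> \<open>As an upper bound of a norm, \<open>R'\<close> is nonnegative; hence the zero
    block that \<open>shift\<close> inserts obeys the same bound.\<close>
  then have R'_nonneg: "0 \<le> R'"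
    using l2_norm_vec_nonneg order_trans by blast
  have le_shift: "l2_norm_vec (shift n X j) \<le> R'"
    using le R'_nonneg by (cases j) auto
  have \<Psi>X: "\<Psi> *\<^sub>v shift n X j \<in> carrier_vec n"
    using \<Psi> X by (intro mult_mat_vec_carrier[of _ n n])
  have "l2_norm_vec (X j - \<Psi> *\<^sub>v shift n X j)
      \<le> l2_norm_vec (X j) + l2_norm_vec (\<Psi> *\<^sub>v shift n X j)"
    using X \<Psi>X by (intro l2_norm_vec_diff)
  also have "\<dots> \<le> R' + l2_norm_mat \<Psi> * R'"
    using l2_norm_mat_mult_vec[of "shift n X j" \<Psi>] X \<Psi>
      mult_left_mono[OF le_shift nonneg(2)] le[of j] by simp
  finally have "l2_norm_mat Q * l2_norm_vec (X j - \<Psi> *\<^sub>v shift n X j)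
      \<le> l2_norm_mat Q * (R' + l2_norm_mat \<Psi> * R')"
    using nonneg(1) by (rule mult_left_mono)
  moreover have "l2_norm_vec (bidiag n Q \<Psi> X j)
      \<le> l2_norm_mat Q * l2_norm_vec (X j - \<Psi> *\<^sub>v shift n X j)"
    unfolding bidiag_def using Q X \<Psi>X by (intro l2_norm_mat_mult_vec) (auto intro!: minus_carrier_vec)
  ultimately show ?case
    by (simp add: X_def R'_def algebra_simps)
qed

section \<open>From the action on sequences to the norm bound\<close>

text \<open>One factor \<open>E\<close> turns the outermost \<open>bidiag\<close> into a
  \<open>delay\<close>, which is then moved inside the remaining \<open>bidiag\<close> factors, so
  that the induction continues with \<open>delay n s D U\<close> in place of
  \<open>U\<close>.\<close>

lemma pow_mult_stack:
  assumes E: "E \<in> carrier_mat (N * n) (N * n)"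
    and E_act: "\<And>U. (\<And>j. U j \<in> carrier_vec n) \<Longrightarrow>
        E *\<^sub>v stack N n (bidiag n Q \<Psi> U) = stack N n (delay n s D U)"
    and comm: "m \<le> 1 \<or> Q * D = D * Q \<and> \<Psi> * D = D * \<Psi>"
    and U: "\<And>j. U j \<in> carrier_vec n"
  shows "E ^\<^sub>m m *\<^sub>v stack N n ((bidiag n Q \<Psi> ^^ m) U) = stack N n ((delay n s D ^^ m) U)"
  using comm U
proof (induction m arbitrary: U)
  case 0
  then show ?case using E by simp
next
  case (Suc m)
  have "E ^\<^sub>m Suc m *\<^sub>v stack N n ((bidiag n Q \<Psi> ^^ Suc m) U)
      = E ^\<^sub>m m *\<^sub>v (E *\<^sub>v stack N n (bidiag n Q \<Psi> ((bidiag n Q \<Psi> ^^ m) U)))"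
    using E by (simp add: assoc_mult_mat_vec[of _ "N * n" "N * n" _ "N * n"])
  also have "\<dots> = E ^\<^sub>m m *\<^sub>v stack N n (delay n s D ((bidiag n Q \<Psi> ^^ m) U))"
    using Suc.prems by (simp add: E_act)
  \<comment> \<open>For \<open>m = 0\<close> there is nothing to exchange, so the first power gets
    by without commutation.\<close>
  also have "delay n s D ((bidiag n Q \<Psi> ^^ m) U) = (bidiag n Q \<Psi> ^^ m) (delay n s D U)"
    using Suc.prems by (cases m) (auto intro: delay_bidiag_pow simp del: funpow.simps(2))
  also have "E ^\<^sub>m m *\<^sub>v stack N n \<dots> = stack N n ((delay n s D ^^ m) (delay n s D U))"
    using Suc.prems by (intro Suc.IH) auto
  finally show ?case
    by (simp add: funpow_swap1)
qed

text \<open>The common core of F-relaxation (\<open>s = 1\<close>) and FCF-relaxation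
  (\<open>s = 2\<close>). Minimality of \<open>\<phi>\<close> is used only by exhibiting, for each
  large \<open>N\<close>, another admissible constant.\<close>

lemma asymp_lower_bound_min_constant:
  fixes E :: "nat \<Rightarrow> complex mat"
  assumes n: "0 < n"
    and E: "\<And>N. E N \<in> carrier_mat (N * n) (N * n)"
    and E_act: "\<And>N U. (\<And>j. U j \<in> carrier_vec n) \<Longrightarrow>
        E N *\<^sub>v stack N n (bidiag n Q \<Psi> U) = stack N n (delay n s D U)"
    and comm: "p = 1 \<or> Q * D = D * Q \<and> \<Psi> * D = D * \<Psi>"
    and K: "\<And>x v. v \<in> carrier_vec n \<Longrightarrow>
        l2_norm_vec v \<le> K * l2_norm_vec ((Q * (1\<^sub>m n - cis x \<cdot>\<^sub>m \<Psi>)) ^\<^sub>m p *\<^sub>v v)"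
    and min: "is_min_constant (\<lambda>c. \<forall>v \<in> carrier_vec n. l2_norm_vec (D ^\<^sub>m p *\<^sub>v v) \<le>
        c * (INF x \<in> {0..2 * pi}. l2_norm_vec ((Q * (1\<^sub>m n - cis x \<cdot>\<^sub>m \<Psi>)) ^\<^sub>m p *\<^sub>v v))) \<phi>"
  shows "asymp_lower_bound (\<lambda>N. l2_norm_mat (E N ^\<^sub>m p)) \<phi>"
proof -
  let ?P = "\<lambda>x. Q * (1\<^sub>m n - cis x \<cdot>\<^sub>m \<Psi>)"
  \<comment> \<open>\<open>L\<close> is the growth of the front blocks relative to \<open>v\<close>,
    and \<open>L * K\<close> that relative to a regular input block. \<open>C\<close> collects the
    squared contributions of the \<open>p\<close> front blocks, and the summand \<open>s * p\<close>
    in \<open>\<epsilon>\<close> pays for the output blocks that are lost.\<close>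
  define L where "L = (l2_norm_mat Q * (1 + l2_norm_mat \<Psi>)) ^ p"
  define C where "C = real p * (L * K)\<^sup>2"
  define \<epsilon> where "\<epsilon> N = (C + real (s * p)) / real N" for N
  have C: "0 \<le> C"
    by (simp add: C_def)
  have L: "0 \<le> L"
    using n Q \<Psi> unfolding L_def
    by (intro zero_le_power mult_nonneg_nonneg add_nonneg_nonneg l2_norm_mat_nonneg) auto
  have \<epsilon>: "0 \<le> \<epsilon> N" for N
    using C by (simp add: \<epsilon>_def)
  have test: "real (N - s * p) * (l2_norm_vec (D ^\<^sub>m p *\<^sub>v v))\<^sup>2
      \<le> (l2_norm_mat (E N ^\<^sub>m p))\<^sup>2 * ((C + real N) * (l2_norm_vec (?P x ^\<^sub>m p *\<^sub>v v))\<^sup>2)"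
    if v: "v \<in> carrier_vec n" and N: "0 < N" for v x N
  proof -
    define U where "U j = cis (- (real j * x)) \<cdot>\<^sub>v v" for j
    define V where "V = (bidiag n Q \<Psi> ^^ p) U"
    define W where "W = (delay n s D ^^ p) U"
    let ?b = "l2_norm_vec (?P x ^\<^sub>m p *\<^sub>v v)"
    have U: "U j \<in> carrier_vec n" for j
      using v by (simp add: U_def)
    have V: "V j \<in> carrier_vec n" and W: "W j \<in> carrier_vec n" for j
      using U by (simp_all add: V_def W_def)
    have early: "(l2_norm_vec (V j))\<^sup>2 \<le> (L * K)\<^sup>2 * ?b\<^sup>2" for j
    proof -
      have "l2_norm_vec (V j) \<le> L * l2_norm_vec v"
        unfolding V_def L_def using U n by (intro bidiag_pow_bounded) (auto simp: U_def l2_norm_vec_smult)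
      also have "\<dots> \<le> L * (K * ?b)"
        using K[OF v] L by (rule mult_left_mono)
      finally have "(l2_norm_vec (V j))\<^sup>2 \<le> (L * (K * ?b))\<^sup>2"
        by (rule power_mono) simp
      then show ?thesis
        by (simp add: power_mult_distrib mult.assoc)
    qed
    have late: "(l2_norm_vec (V j))\<^sup>2 = ?b\<^sup>2" if "p \<le> j" for j
      using bidiag_pow_geometric[of U v 0 x p j] that U v
      by (simp add: V_def U_def l2_norm_vec_smult)
    have "(l2_norm_vec (stack N n V))\<^sup>2 = (\<Sum>j<N. (l2_norm_vec (V j))\<^sup>2)"
      using V by (rule l2_norm_vec_stack)
    \<comment> \<open>Every block is charged the regular amount, and the front blocks their crude
      bound in addition, so the range need not be split.\<close>
    also have "\<dots> \<le> (\<Sum>j<N. ?b\<^sup>2 + (if j < p then (L * K)\<^sup>2 * ?b\<^sup>2 else 0))"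
      using early late by (intro sum_mono) (auto simp: not_less intro: add_increasing)
    also have "\<dots> = real N * ?b\<^sup>2 + real (card {j. j < N \<and> j < p}) * ((L * K)\<^sup>2 * ?b\<^sup>2)"
      by (simp add: sum.distrib sum.If_cases Int_def)
    also have "\<dots> \<le> real N * ?b\<^sup>2 + real p * ((L * K)\<^sup>2 * ?b\<^sup>2)"
      using card_mono[of "{..<p}" "{j. j < N \<and> j < p}"]
      by (intro add_left_mono mult_right_mono) auto
    finally have V_norm: "(l2_norm_vec (stack N n V))\<^sup>2 \<le> (C + real N) * ?b\<^sup>2"
      by (simp add: C_def algebra_simps)
    \<comment> \<open>The output blocks from index \<open>s * p\<close> on all have the same norm,
      since the phases have modulus 1; the earlier ones are dropped.\<close>
    have "real (N - s * p) * (l2_norm_vec (D ^\<^sub>m p *\<^sub>v v))\<^sup>2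
        = (\<Sum>j<N - s * p. (l2_norm_vec (W (j + s * p)))\<^sup>2)"
      using U D v delay_pow_add[of U, where s = s and m = p]
      by (simp add: W_def U_def mult_mat_vec[of _ n n] l2_norm_vec_smult)
    also have "\<dots> = (\<Sum>j\<in>(\<lambda>j. j + s * p) ` {..<N - s * p}. (l2_norm_vec (W j))\<^sup>2)"
      by (simp add: sum.reindex)
    also have "\<dots> \<le> (\<Sum>j<N. (l2_norm_vec (W j))\<^sup>2)"
      by (intro sum_mono2) auto
    also have "\<dots> = (l2_norm_vec (stack N n W))\<^sup>2"
      using W by (rule l2_norm_vec_stack[symmetric])
    also have "stack N n W = E N ^\<^sub>m p *\<^sub>v stack N n V"
      unfolding V_def W_def using E E_act comm U by (intro pow_mult_stack[symmetric]) auto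
    also have "(l2_norm_vec \<dots>)\<^sup>2 \<le> (l2_norm_mat (E N ^\<^sub>m p) * l2_norm_vec (stack N n V))\<^sup>2"
      using E[of N] by (intro power_mono l2_norm_mat_mult_vec) auto
    also have "\<dots> \<le> (l2_norm_mat (E N ^\<^sub>m p))\<^sup>2 * ((C + real N) * ?b\<^sup>2)"
      unfolding power_mult_distrib using V_norm by (rule mult_left_mono) simp
    finally show ?thesis .
  qed
  have bound: "\<phi> / (1 + \<epsilon> N) \<le> l2_norm_mat (E N ^\<^sub>m p)" if N: "2 * (s * p) \<le> N" "0 < N" for N
  proof -
    let ?e = "l2_norm_mat (E N ^\<^sub>m p)"
    have e: "0 \<le> ?e"
      using E[of N] n N by (intro l2_norm_mat_nonneg) auto
    have pos: "0 < real (N - s * p)"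
      using N unfolding of_nat_0_less_iff by linarith
    have "C + real N = (C + real (s * p)) + real (N - s * p)"
      using N by (simp add: of_nat_diff)
    also have "\<dots> = \<epsilon> N * real N + real (N - s * p)"
      using N by (simp add: \<epsilon>_def)
    \<comment> \<open>At least half of the output blocks remain, so the excess is at most a factor
      \<open>1 + 2 * \<epsilon> N\<close>. This is below the square of
      \<open>1 + \<epsilon> N\<close>, as needed for taking roots later.\<close>
    also have "\<dots> \<le> \<epsilon> N * (2 * real (N - s * p)) + real (N - s * p)"
    proof (intro add_right_mono mult_left_mono)
      have "N \<le> 2 * (N - s * p)"
        using N by linarith
      then have "real N \<le> real (2 * (N - s * p))"
        by (rule of_nat_mono)
      then show "real N \<le> 2 * real (N - s * p)"
        by simp
    qed (rule \<epsilon>)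
    also have "\<dots> \<le> (1 + \<epsilon> N)\<^sup>2 * real (N - s * p)"
      using \<epsilon>[of N] by (simp add: power2_eq_square algebra_simps)
    finally have CN: "C + real N \<le> (1 + \<epsilon> N)\<^sup>2 * real (N - s * p)" .
    have "l2_norm_vec (D ^\<^sub>m p *\<^sub>v v) \<le> ?e * (1 + \<epsilon> N) * l2_norm_vec (?P x ^\<^sub>m p *\<^sub>v v)"
      if v: "v \<in> carrier_vec n" for v x
    proof (rule power2_le_imp_le)
      let ?a = "l2_norm_vec (D ^\<^sub>m p *\<^sub>v v)" and ?b = "l2_norm_vec (?P x ^\<^sub>m p *\<^sub>v v)"
      have "real (N - s * p) * ?a\<^sup>2 \<le> ?e\<^sup>2 * ((C + real N) * ?b\<^sup>2)"
        using v N by (intro test)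
      also have "\<dots> \<le> ?e\<^sup>2 * (((1 + \<epsilon> N)\<^sup>2 * real (N - s * p)) * ?b\<^sup>2)"
        using CN by (intro mult_left_mono mult_right_mono) auto
      also have "\<dots> = real (N - s * p) * (?e * (1 + \<epsilon> N) * ?b)\<^sup>2"
        by (simp add: power_mult_distrib)
      finally show "?a\<^sup>2 \<le> (?e * (1 + \<epsilon> N) * ?b)\<^sup>2"
        using pos by (rule mult_left_le_imp_le)
      show "0 \<le> ?e * (1 + \<epsilon> N) * ?b"
        using e \<epsilon>[of N] by simp
    qed
    \<comment> \<open>The infimum is a value of the function, so the estimate for every
      \<open>x\<close> passes to it.\<close>
    moreover have "\<exists>y. (INF x \<in> {0..2 * pi}. l2_norm_vec (?P x ^\<^sub>m p *\<^sub>v v))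
        = l2_norm_vec (?P y ^\<^sub>m p *\<^sub>v v)" if "v \<in> carrier_vec n" for v
      using FCF_TAP_min[OF \<Psi> Q that] by blast
    ultimately have "\<forall>v \<in> carrier_vec n. l2_norm_vec (D ^\<^sub>m p *\<^sub>v v) \<le>
        ?e * (1 + \<epsilon> N) * (INF x \<in> {0..2 * pi}. l2_norm_vec (?P x ^\<^sub>m p *\<^sub>v v))"
      by metis
    with min have "\<phi> \<le> ?e * (1 + \<epsilon> N)"
      unfolding is_min_constant_def by blast
    then show ?thesis
      using \<epsilon>[of N] by (simp add: divide_le_eq)
  qed
  \<comment> \<open>The error is a multiple of \<open>1 / N\<close>, which is at most
    \<open>1 / sqrt N\<close> for \<open>N \<ge> 1\<close>.\<close>
  have "\<epsilon> \<in> O(\<lambda>N. 1 / sqrt (real N))"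
  proof (rule bigoI)
    show "\<forall>\<^sub>F N in sequentially. norm (\<epsilon> N) \<le> (C + real (s * p)) * norm (1 / sqrt (real N))"
    proof (rule eventually_sequentiallyI)
      fix N :: nat assume N: "1 \<le> N"
      have "sqrt (real N) \<le> real N"
        using N by (intro real_le_lsqrt) (auto simp: power2_eq_square)
      then have "1 / real N \<le> 1 / sqrt (real N)"
        using N by (intro divide_left_mono) auto
      then have "(C + real (s * p)) * (1 / real N) \<le> (C + real (s * p)) * (1 / sqrt (real N))"
        using C by (intro mult_left_mono) auto
      then show "norm (\<epsilon> N) \<le> (C + real (s * p)) * norm (1 / sqrt (real N))"
        using C by (simp add: \<epsilon>_def)
    qed
  qed
  moreover have "\<forall>\<^sub>F N in sequentially. \<phi> / (1 + \<epsilon> N) \<le> l2_norm_mat (E N ^\<^sub>m p)"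
    by (rule eventually_sequentiallyI[of "Suc (2 * (s * p))"]) (use bound in auto)
  ultimately show ?thesis
    using \<epsilon> unfolding asymp_lower_bound_def by blast
qed

end

subsection \<open>The error propagation matrices\<close>

text \<open>The input is \<open>B_Delta\<close> applied to the stack of \<open>U\<close>, so the
  inverse cancels and the difference of \<open>B_Delta\<close> and \<open>A_Delta\<close> remains.
  Their identity blocks cancel too, which leaves one subdiagonal.\<close>

lemma err_F_mult_stack:
  assumes \<Phi>: "\<Phi> \<in> carrier_mat n n" and \<Psi>: "\<Psi> \<in> carrier_mat n n"
    and U: "\<And>j. U j \<in> carrier_vec n"
  shows "err_F \<Phi> \<Psi> k N *\<^sub>v stack N n (bidiag n (1\<^sub>m n) \<Psi> U) = stack N n (delay n 1 (\<Phi> ^\<^sub>m k - \<Psi>) U)"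
proof -
  let ?A = "A_Delta \<Phi> k N" and ?B = "B_Delta \<Psi> N"
  have A: "?A \<in> carrier_mat (N * n) (N * n)" and B: "?B \<in> carrier_mat (N * n) (N * n)"
    using \<Phi> \<Psi> by (auto simp: A_Delta_def B_Delta_def intro!: subdiag_matrix_carrier)
  note B_inv = mat_inv[OF B invertible_B_Delta[OF \<Psi>]]
  have dims: "dim_row \<Phi> = n" "dim_row \<Psi> = n"
    using \<Phi> \<Psi> by auto
  have \<Phi>k: "\<Phi> ^\<^sub>m k \<in> carrier_mat n n"
    using \<Phi> by simp
  have sU: "shift n U j \<in> carrier_vec n" for j
    using U by simp
  note mv = mult_mat_vec_carrier[OF \<Phi>k sU] mult_mat_vec_carrier[OF \<Psi> sU]
  have BU: "?B *\<^sub>v stack N n U = stack N n (\<lambda>j. U j - \<Psi> *\<^sub>v shift n U j)"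
    unfolding B_Delta_def dims using \<Psi> U sU mv
    by (subst subdiag_matrix_mult_stack) (auto simp: minus_add_uminus_vec[of _ n])
  have AU: "?A *\<^sub>v stack N n U = stack N n (\<lambda>j. U j - \<Phi> ^\<^sub>m k *\<^sub>v shift n U j)"
    unfolding A_Delta_def dims using \<Phi>k U sU mv
    by (subst subdiag_matrix_mult_stack) (auto simp: minus_add_uminus_vec[of _ n])
  have "bidiag n (1\<^sub>m n) \<Psi> U = (\<lambda>j. U j - \<Psi> *\<^sub>v shift n U j)"
    using U mv by (auto simp: bidiag_def)
  with BU have "err_F \<Phi> \<Psi> k N *\<^sub>v stack N n (bidiag n (1\<^sub>m n) \<Psi> U)
      = (1\<^sub>m (N * n) - ?A * mat_inv ?B) *\<^sub>v (?B *\<^sub>v stack N n U)"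
    by (simp add: err_F_def dims)
  also have "\<dots> = ?B *\<^sub>v stack N n U - (?A * mat_inv ?B) *\<^sub>v (?B *\<^sub>v stack N n U)"
    using mult_mat_vec_carrier[OF B stack_carrier] mult_carrier_mat[OF A B_inv(1)]
    by (simp add: minus_mult_distrib_mat_vec[of _ "N * n" "N * n"])
  also have "(?A * mat_inv ?B) *\<^sub>v (?B *\<^sub>v stack N n U) = ?A *\<^sub>v ((mat_inv ?B * ?B) *\<^sub>v stack N n U)"
    by (simp only: assoc_mult_mat_vec[OF A B_inv(1) mult_mat_vec_carrier[OF B stack_carrier]]
        assoc_mult_mat_vec[OF B_inv(1) B stack_carrier])
  also have "\<dots> = ?A *\<^sub>v stack N n U"
    by (simp add: B_inv(3))
  also have "?B *\<^sub>v stack N n U - ?A *\<^sub>v stack N n U = stack N n (delay n 1 (\<Phi> ^\<^sub>m k - \<Psi>) U)"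
  proof (rule eq_vecI)
    fix r assume "r < dim_vec (stack N n (delay n 1 (\<Phi> ^\<^sub>m k - \<Psi>) U))"
    then have r: "r < N * n" by simp
    then have l: "r mod n < n" by (cases n) auto
    have "dim_vec (U j) = n" for j
      using U[of j] by simp
    with r l show "(?B *\<^sub>v stack N n U - ?A *\<^sub>v stack N n U) $ r
        = stack N n (delay n 1 (\<Phi> ^\<^sub>m k - \<Psi>) U) $ r"
      unfolding AU BU using mv \<Phi> \<Psi>
      by (simp add: stack_def delay_def minus_mult_distrib_mat_vec[OF \<Phi>k \<Psi> sU])
  qed (use AU BU in simp)
  finally show ?thesis .
qed

lemma err_F_carrier:
  assumes \<Phi>: "\<Phi> \<in> carrier_mat n n" and \<Psi>: "\<Psi> \<in> carrier_mat n n"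
  shows "err_F \<Phi> \<Psi> k N \<in> carrier_mat (N * n) (N * n)"
proof -
  have A: "A_Delta \<Phi> k N \<in> carrier_mat (N * n) (N * n)"
    and B: "B_Delta \<Psi> N \<in> carrier_mat (N * n) (N * n)"
    using \<Phi> \<Psi> by (auto simp: A_Delta_def B_Delta_def intro!: subdiag_matrix_carrier)
  show ?thesis
    using mult_carrier_mat[OF A mat_inv(1)[OF B invertible_B_Delta[OF \<Psi>]]] \<Phi>
    by (auto simp: err_F_def intro: minus_carrier_mat)
qed

lemma A_cf_ff_fc_carrier:
  assumes "\<Phi> \<in> carrier_mat n n"
  shows "A_cf_ff_fc \<Phi> k N \<in> carrier_mat (N * n) (N * n)"
  using assms by (auto simp: A_cf_ff_fc_def intro!: subdiag_matrix_carrier)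

lemma err_FCF_carrier:
  assumes "\<Phi> \<in> carrier_mat n n" and "\<Psi> \<in> carrier_mat n n"
  shows "err_FCF \<Phi> \<Psi> k N \<in> carrier_mat (N * n) (N * n)"
  unfolding err_FCF_def
  using err_F_carrier[OF assms] A_cf_ff_fc_carrier[OF assms(1)] by (rule mult_carrier_mat)

text \<open>The factor \<open>A_cf_ff_fc\<close> shifts once and multiplies by the power of \<Phi>,
  which cancels \<open>Q\<close>. The result is an input for the F-case built from
  \<open>shift n U\<close>, and the two delays add up to 2.\<close>

lemma err_FCF_mult_stack:
  assumes \<Phi>: "\<Phi> \<in> carrier_mat n n" and inv: "invertible_mat \<Phi>" and \<Psi>: "\<Psi> \<in> carrier_mat n n"
    and U: "\<And>j. U j \<in> carrier_vec n"
  shows "err_FCF \<Phi> \<Psi> k N *\<^sub>v stack N n (bidiag n (mat_inv (\<Phi> ^\<^sub>m k)) \<Psi> U)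
    = stack N n (delay n 2 (\<Phi> ^\<^sub>m k - \<Psi>) U)"
proof -
  let ?S = "A_cf_ff_fc \<Phi> k N" and ?Q = "mat_inv (\<Phi> ^\<^sub>m k)"
  have \<Phi>k: "\<Phi> ^\<^sub>m k \<in> carrier_mat n n"
    using \<Phi> by simp
  note Q = mat_inv[OF \<Phi>k invertible_mat_pow[OF \<Phi> inv]]
  have sU: "shift n U j \<in> carrier_vec n" for j
    using U by simp
  have D: "\<Phi> ^\<^sub>m k - \<Psi> \<in> carrier_mat n n"
    using \<Psi> by (rule minus_carrier_mat)
  have V: "bidiag n ?Q \<Psi> X j \<in> carrier_vec n" if "\<And>j. X j \<in> carrier_vec n" for X j
    using that by (rule bidiag_carrier[OF Q(1) \<Psi> D])
  have cancel: "\<Phi> ^\<^sub>m k *\<^sub>v bidiag n ?Q \<Psi> X j = bidiag n (1\<^sub>m n) \<Psi> X j"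
    if X: "\<And>j. X j \<in> carrier_vec n" for X j
  proof -
    have w: "X j - \<Psi> *\<^sub>v shift n X j \<in> carrier_vec n"
      using X \<Psi> by (intro minus_carrier_vec mult_mat_vec_carrier[of _ n n]) auto
    then show ?thesis
      by (simp add: bidiag_def assoc_mult_mat_vec[OF \<Phi>k Q(1) w, symmetric] Q(2))
  qed
  have "?S *\<^sub>v stack N n (bidiag n ?Q \<Psi> U)
      = stack N n (\<lambda>j. 0\<^sub>m n n *\<^sub>v bidiag n ?Q \<Psi> U j + \<Phi> ^\<^sub>m k *\<^sub>v shift n (bidiag n ?Q \<Psi> U) j)"
    using \<Phi> \<Phi>k V[OF U] unfolding A_cf_ff_fc_def
    by (subst subdiag_matrix_mult_stack) auto
  also have "(\<lambda>j. 0\<^sub>m n n *\<^sub>v bidiag n ?Q \<Psi> U j + \<Phi> ^\<^sub>m k *\<^sub>v shift n (bidiag n ?Q \<Psi> U) j)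
      = bidiag n (1\<^sub>m n) \<Psi> (shift n U)"
  proof
    fix j
    have "0\<^sub>m n n *\<^sub>v bidiag n ?Q \<Psi> U j = 0\<^sub>v n"
      using V[where X = U and j = j, OF U] by (auto intro!: eq_vecI)
    moreover have "\<Phi> ^\<^sub>m k *\<^sub>v shift n (bidiag n ?Q \<Psi> U) j = bidiag n (1\<^sub>m n) \<Psi> (shift n U) j"
      using U sU by (simp add: shift_bidiag[OF Q(1) \<Psi> D] cancel)
    moreover have "bidiag n (1\<^sub>m n) \<Psi> (shift n U) j \<in> carrier_vec n"
      using sU by (rule bidiag_carrier[OF one_carrier_mat \<Psi> D])
    ultimately show "0\<^sub>m n n *\<^sub>v bidiag n ?Q \<Psi> U j + \<Phi> ^\<^sub>m k *\<^sub>v shift n (bidiag n ?Q \<Psi> U) j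
        = bidiag n (1\<^sub>m n) \<Psi> (shift n U) j"
      by simp
  qed
  finally have "err_FCF \<Phi> \<Psi> k N *\<^sub>v stack N n (bidiag n ?Q \<Psi> U)
      = err_F \<Phi> \<Psi> k N *\<^sub>v stack N n (bidiag n (1\<^sub>m n) \<Psi> (shift n U))"
    unfolding err_FCF_def
    by (simp add: assoc_mult_mat_vec[OF err_F_carrier[OF \<Phi> \<Psi>] A_cf_ff_fc_carrier[OF \<Phi>] stack_carrier])
  also have "\<dots> = stack N n (delay n 1 (\<Phi> ^\<^sub>m k - \<Psi>) (shift n U))"
    using \<Phi> \<Psi> sU by (rule err_F_mult_stack)
  also have "delay n 1 (\<Phi> ^\<^sub>m k - \<Psi>) (shift n U) = delay n 2 (\<Phi> ^\<^sub>m k - \<Psi>) U"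
    by (simp add: delay_def[abs_def] numeral_2_eq_2)
  finally show ?thesis .
qed

section \<open>Commutation with powers and inverses\<close>

lemma pow_mat_commute:
  assumes A: "(A :: complex mat) \<in> carrier_mat n n" and B: "B \<in> carrier_mat n n"
    and AB: "A * B = B * A"
  shows "A ^\<^sub>m k * B = B * A ^\<^sub>m k"
proof (induction k)
  case 0
  then show ?case using A B by simp
next
  case (Suc k)
  have Ak: "A ^\<^sub>m k \<in> carrier_mat n n"
    using A by simp
  have "A ^\<^sub>m Suc k * B = A ^\<^sub>m k * (A * B)"
    using assoc_mult_mat[OF Ak A B] by simp
  also have "\<dots> = (A ^\<^sub>m k * B) * A"
    unfolding AB by (rule assoc_mult_mat[OF Ak B A, symmetric])
  also have "\<dots> = B * A ^\<^sub>m Suc k"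
    using assoc_mult_mat[OF B Ak A] by (simp add: Suc.IH)
  finally show ?case .
qed

lemma mat_inv_commute:
  assumes A: "A \<in> carrier_mat n n" and inv: "invertible_mat A" and B: "B \<in> carrier_mat n n"
    and AB: "A * B = B * A"
  shows "mat_inv A * B = B * mat_inv A"
proof -
  note Q = mat_inv[OF A inv]
  have "mat_inv A * B = mat_inv A * (B * (A * mat_inv A))"
    using B Q by simp
  also have "\<dots> = mat_inv A * ((A * B) * mat_inv A)"
    unfolding AB using assoc_mult_mat[OF B A Q(1)] by simp
  also have "\<dots> = (mat_inv A * A) * (B * mat_inv A)"
    using assoc_mult_mat[OF A B Q(1)] assoc_mult_mat[OF Q(1) A mult_carrier_mat[OF B Q(1)]] by simp
  also have "\<dots> = B * mat_inv A"
    using B Q by simp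
  finally show ?thesis .
qed

theorem theorem4p11:
  fixes \<Phi> \<Psi> :: "complex mat" and n k p :: nat
  assumes "n \<ge> 1" and "k \<ge> 1" and "p \<ge> 1"
    and "\<Phi> \<in> carrier_mat n n" and "\<Psi> \<in> carrier_mat n n"
    and "invertible_mat \<Phi>" and "invertible_mat \<Psi>"
    and "\<exists>q\<ge>1. l2_norm_mat (\<Phi> ^\<^sub>m q) < 1 \<and> l2_norm_mat (\<Psi> ^\<^sub>m q) < 1"
    and "invertible_mat (\<Psi> - \<Phi> ^\<^sub>m k)"
  shows "(\<forall>\<phi>\<^sub>1. is_min_constant (F_TAP \<Phi> \<Psi> k 1) \<phi>\<^sub>1 \<longrightarrow>
            asymp_lower_bound (\<lambda>N. l2_norm_mat (err_F \<Phi> \<Psi> k N)) \<phi>\<^sub>1 \<and>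
            (\<forall>\<phi>. \<Phi> * \<Psi> = \<Psi> * \<Phi> \<and> is_min_constant (F_TAP \<Phi> \<Psi> k p) \<phi> \<longrightarrow>
              asymp_lower_bound (\<lambda>N. l2_norm_mat (err_F \<Phi> \<Psi> k N ^\<^sub>m p)) \<phi>))
       \<and> (\<forall>\<phi>\<^sub>1. is_min_constant (FCF_TAP \<Phi> \<Psi> k 1) \<phi>\<^sub>1 \<longrightarrow>
            asymp_lower_bound (\<lambda>N. l2_norm_mat (err_FCF \<Phi> \<Psi> k N)) \<phi>\<^sub>1 \<and>
            (\<forall>\<phi>. \<Phi> * \<Psi> = \<Psi> * \<Phi> \<and> is_min_constant (FCF_TAP \<Phi> \<Psi> k p) \<phi> \<longrightarrow>
              asymp_lower_bound (\<lambda>N. l2_norm_mat (err_FCF \<Phi> \<Psi> k N ^\<^sub>m p)) \<phi>))"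
proof -
  note \<Phi> = assms(4) and \<Psi> = assms(5)
  let ?D = "\<Phi> ^\<^sub>m k - \<Psi>" and ?Q = "mat_inv (\<Phi> ^\<^sub>m k)"
  have n: "0 < n" and dim: "dim_row \<Phi> = n"
    using assms(1) \<Phi> by auto
  have \<Phi>k: "\<Phi> ^\<^sub>m k \<in> carrier_mat n n"
    using \<Phi> by simp
  note Q = mat_inv[OF \<Phi>k invertible_mat_pow[OF \<Phi> assms(6)]]
  have D: "?D \<in> carrier_mat n n"
    using \<Psi> by (rule minus_carrier_mat)
  have R: "1\<^sub>m n - cis x \<cdot>\<^sub>m \<Psi> \<in> carrier_mat n n" for x
    using \<Psi> by (intro minus_carrier_mat smult_carrier_mat)
  have "- (A - B) = B - A" if "A \<in> carrier_mat n n" "B \<in> carrier_mat n n" for A B :: "complex mat"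
    using that by (intro eq_matI) auto
  from this[OF \<Phi>k \<Psi>] have D_norm: "l2_norm_vec ((\<Psi> - \<Phi> ^\<^sub>m k) ^\<^sub>m m *\<^sub>v v) = l2_norm_vec (?D ^\<^sub>m m *\<^sub>v v)"
    if "v \<in> carrier_vec n" for m v
    using l2_norm_vec_uminus_pow[OF D that, of m] by simp
  obtain q where "l2_norm_mat (\<Psi> ^\<^sub>m q) < 1"
    using assms(8) by blast
  from vec_le_resolvent[OF n \<Psi> this] obtain K where K: "0 \<le> K"
    "\<And>x v. v \<in> carrier_vec n \<Longrightarrow> l2_norm_vec v \<le> K * l2_norm_vec ((1\<^sub>m n - cis x \<cdot>\<^sub>m \<Psi>) *\<^sub>v v)"
    by blast
  have norm_\<Phi>k: "0 \<le> l2_norm_mat (\<Phi> ^\<^sub>m k)"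
    using n \<Phi> by (intro l2_norm_mat_nonneg) simp
  \<comment> \<open>Multiplying by \<open>?Q\<close> shrinks a vector by at most the norm of
    \<open>\<Phi> ^\<^sub>m k\<close>, because that power undoes \<open>?Q\<close>; so the uniform
    bound survives the extra factor.\<close>
  have KQ: "l2_norm_vec v
      \<le> K * l2_norm_mat (\<Phi> ^\<^sub>m k) * l2_norm_vec ((?Q * (1\<^sub>m n - cis x \<cdot>\<^sub>m \<Psi>)) *\<^sub>v v)"
    if v: "v \<in> carrier_vec n" for v x
  proof -
    let ?w = "(1\<^sub>m n - cis x \<cdot>\<^sub>m \<Psi>) *\<^sub>v v"
    have w: "?w \<in> carrier_vec n"
      by (rule mult_mat_vec_carrier[OF R v])
    have Qw: "?Q *\<^sub>v ?w \<in> carrier_vec (dim_col (\<Phi> ^\<^sub>m k))"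
      unfolding carrier_matD(2)[OF \<Phi>k] by (rule mult_mat_vec_carrier[OF Q(1) w])
    have "?w = \<Phi> ^\<^sub>m k *\<^sub>v (?Q *\<^sub>v ?w)"
      using w by (simp only: assoc_mult_mat_vec[OF \<Phi>k Q(1) w, symmetric] Q(2) one_mult_mat_vec)
    with l2_norm_mat_mult_vec[OF Qw]
    have "l2_norm_vec ?w \<le> l2_norm_mat (\<Phi> ^\<^sub>m k) * l2_norm_vec (?Q *\<^sub>v ?w)"
      by simp
    from mult_left_mono[OF this K(1)] K(2)[OF v, of x] show ?thesis
      by (simp add: assoc_mult_mat_vec[OF Q(1) R v] mult.assoc)
  qed
  have comm: "\<Psi> * ?D = ?D * \<Psi> \<and> ?Q * ?D = ?D * ?Q" if "\<Phi> * \<Psi> = \<Psi> * \<Phi>"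
  proof -
    have \<Phi>\<Psi>: "\<Phi> ^\<^sub>m k * \<Psi> = \<Psi> * \<Phi> ^\<^sub>m k"
      using \<Phi> \<Psi> that by (rule pow_mat_commute)
    then have "\<Phi> ^\<^sub>m k * ?D = ?D * \<Phi> ^\<^sub>m k"
      using \<Phi>k \<Psi> by (simp add: mult_minus_distrib_mat[of _ n n] minus_mult_distrib_mat[of _ n n])
    then show ?thesis
      using \<Phi>\<Psi> \<Phi>k \<Psi> D mat_inv_commute[OF \<Phi>k invertible_mat_pow[OF \<Phi> assms(6)] D]
      by (simp add: mult_minus_distrib_mat[of _ n n] minus_mult_distrib_mat[of _ n n])
  qed
  \<comment> \<open>The exponent is general, so that \<open>m = 1\<close> without commutation and
    \<open>m = p\<close> with it are instances of one claim.\<close>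
  have F: "asymp_lower_bound (\<lambda>N. l2_norm_mat (err_F \<Phi> \<Psi> k N ^\<^sub>m m)) \<phi>"
    if min: "is_min_constant (F_TAP \<Phi> \<Psi> k m) \<phi>" and c: "m = 1 \<or> \<Phi> * \<Psi> = \<Psi> * \<Phi>" for m \<phi>
  proof (rule asymp_lower_bound_min_constant[OF one_carrier_mat \<Psi> D n err_F_carrier[OF \<Phi> \<Psi>]
        err_F_mult_stack[OF \<Phi> \<Psi>]])
    show "m = 1 \<or> 1\<^sub>m n * ?D = ?D * 1\<^sub>m n \<and> \<Psi> * ?D = ?D * \<Psi>"
      unfolding left_mult_one_mat[OF D] right_mult_one_mat[OF D] using c comm by auto
    show "l2_norm_vec v \<le> K ^ m * l2_norm_vec ((1\<^sub>m n * (1\<^sub>m n - cis x \<cdot>\<^sub>m \<Psi>)) ^\<^sub>m m *\<^sub>v v)"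
      if "v \<in> carrier_vec n" for x v
      using vec_le_pow_mult_vec[OF R K that] by (simp add: left_mult_one_mat[OF R])
    \<comment> \<open>Reversing the sign of the difference and inserting the identity as
      \<open>Q\<close> puts the property into the form of the core lemma.\<close>
    have "F_TAP \<Phi> \<Psi> k m = (\<lambda>c. \<forall>v \<in> carrier_vec n. l2_norm_vec (?D ^\<^sub>m m *\<^sub>v v) \<le> c *
        (INF x \<in> {0..2 * pi}. l2_norm_vec ((1\<^sub>m n * (1\<^sub>m n - cis x \<cdot>\<^sub>m \<Psi>)) ^\<^sub>m m *\<^sub>v v)))"
      by (auto simp: F_TAP_def[abs_def] dim D_norm left_mult_one_mat[OF R])
    with min show "is_min_constant (\<lambda>c. \<forall>v \<in> carrier_vec n. l2_norm_vec (?D ^\<^sub>m m *\<^sub>v v) \<le> c *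
        (INF x \<in> {0..2 * pi}. l2_norm_vec ((1\<^sub>m n * (1\<^sub>m n - cis x \<cdot>\<^sub>m \<Psi>)) ^\<^sub>m m *\<^sub>v v))) \<phi>"
      by simp
  qed
  have FCF: "asymp_lower_bound (\<lambda>N. l2_norm_mat (err_FCF \<Phi> \<Psi> k N ^\<^sub>m m)) \<phi>"
    if min: "is_min_constant (FCF_TAP \<Phi> \<Psi> k m) \<phi>" and c: "m = 1 \<or> \<Phi> * \<Psi> = \<Psi> * \<Phi>" for m \<phi>
  proof (rule asymp_lower_bound_min_constant[OF Q(1) \<Psi> D n err_FCF_carrier[OF \<Phi> \<Psi>]
        err_FCF_mult_stack[OF \<Phi> assms(6) \<Psi>]])
    show "m = 1 \<or> ?Q * ?D = ?D * ?Q \<and> \<Psi> * ?D = ?D * \<Psi>"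
      using c comm by auto
    show "l2_norm_vec v \<le> (K * l2_norm_mat (\<Phi> ^\<^sub>m k)) ^ m
        * l2_norm_vec ((?Q * (1\<^sub>m n - cis x \<cdot>\<^sub>m \<Psi>)) ^\<^sub>m m *\<^sub>v v)"
      if "v \<in> carrier_vec n" for x v
      using vec_le_pow_mult_vec[OF mult_carrier_mat[OF Q(1) R] _ KQ that] K(1) norm_\<Phi>k by simp
    have "FCF_TAP \<Phi> \<Psi> k m = (\<lambda>c. \<forall>v \<in> carrier_vec n. l2_norm_vec (?D ^\<^sub>m m *\<^sub>v v) \<le> c *
        (INF x \<in> {0..2 * pi}. l2_norm_vec ((?Q * (1\<^sub>m n - cis x \<cdot>\<^sub>m \<Psi>)) ^\<^sub>m m *\<^sub>v v)))"
      by (auto simp: FCF_TAP_def[abs_def] dim D_norm)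
    with min show "is_min_constant (\<lambda>c. \<forall>v \<in> carrier_vec n. l2_norm_vec (?D ^\<^sub>m m *\<^sub>v v) \<le> c *
        (INF x \<in> {0..2 * pi}. l2_norm_vec ((?Q * (1\<^sub>m n - cis x \<cdot>\<^sub>m \<Psi>)) ^\<^sub>m m *\<^sub>v v))) \<phi>"
      by simp
  qed
  have pow_1: "A ^\<^sub>m 1 = A" if "A \<in> carrier_mat (N * n) (N * n)" for A :: "complex mat" and N
    using that by simp
  show ?thesis
    using F[of 1] FCF[of 1] F[of p] FCF[of p]
    by (auto simp: pow_1[OF err_F_carrier[OF \<Phi> \<Psi>]] pow_1[OF err_FCF_carrier[OF \<Phi> \<Psi>]])
qed

end
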